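(* Let $K=\mathbb{Q}(\sqrt{D})$ where $D\in\mathbb{Z}_{\ge2}$ is squarefree. If $\alpha=(\lceil\xi_D\rceil+2)+\omega_D$, then $p_K(\alpha)=4$.
   Context: Let $\omega_D=\sqrt{D}$ and $\xi_D=\sqrt D$ if $D\equiv2,3\pmod4$, and $\omega_D=\frac{1+\sqrt D}{2}$, $\xi_D=\frac{\sqrt D-1}{2}$ if $D\equiv1\pmod4$. $\mathcal{O}_K$ is the ring of integers of $K$ and $\mathcal{O}_K^+$ the set of totally positive elements of $\mathcal{O}_K$ (those $\gamma$ with $\gamma>0$, $\gamma'>0$, $'$ denoting Galois conjugation). A partition of $\alpha\in\mathcal{O}_K^+$ is an expression $\alpha=\alpha_1+\dots+\alpha_n$ with $n\ge1$ and $\alpha_i\in\mathcal{O}_K^+$, order irrelevant; $p_K(\alpha)$ is the number of partitions of $\alpha$. *)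

theory Defs
  imports
    Complex_Main
    "HOL-Library.Multiset"
    "HOL-Computational_Algebra.Polynomial"
    "HOL-Computational_Algebra.Squarefree"
begin

text \<open>
  The real quadratic field $K = Q(\sqrt{D})$, realised as a subfield of the reals.
  Throughout, \<open>D\<close> is meant to be squarefree and at least 2.
\<close>

definition quad_field :: "int \<Rightarrow> real set" where
  "quad_field D = {a + b * sqrt (of_int D) | a b. a \<in> \<rat> \<and> b \<in> \<rat>}"

text \<open>
  Galois conjugation. Outside \<open>quad_field D\<close> the value is unspecified; on \<open>quad_field D\<close> it is
  determined because \<open>sqrt D\<close> is irrational.
\<close>

definition quad_conj :: "int \<Rightarrow> real \<Rightarrow> real" where
  "quad_conj D x = (THE y. \<exists>a\<in>\<rat>. \<exists>b\<in>\<rat>.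
     x = a + b * sqrt (of_int D) \<and> y = a - b * sqrt (of_int D))"

definition ring_of_ints :: "int \<Rightarrow> real set" where
  "ring_of_ints D = {x \<in> quad_field D. algebraic_int x}"

definition tot_pos_ints :: "int \<Rightarrow> real set" where
  "tot_pos_ints D = {x \<in> ring_of_ints D. x > 0 \<and> quad_conj D x > 0}"

definition omega :: "int \<Rightarrow> real" where
  "omega D = (if D mod 4 = 1 then (1 + sqrt (of_int D)) / 2 else sqrt (of_int D))"

definition xi :: "int \<Rightarrow> real" where
  "xi D = (if D mod 4 = 1 then (sqrt (of_int D) - 1) / 2 else sqrt (of_int D))"

definition partitions :: "int \<Rightarrow> real \<Rightarrow> real multiset set" where
  "partitions D \<alpha> = {M. M \<noteq> {#} \<and> set_mset M \<subseteq> tot_pos_ints D \<and> sum_mset M = \<alpha>}"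

text \<open>
  Note that \<open>card\<close> of an infinite set is 0, so a positive value here also asserts that there are
  only finitely many partitions.
\<close>

definition num_partitions :: "int \<Rightarrow> real \<Rightarrow> nat" where
  "num_partitions D \<alpha> = card (partitions D \<alpha>)"

end

theory Submission imports Defs begin

text \<open>
  The totally positive integers are the \<open>x + y\<omega>\<close> with \<open>x, y\<close> integers, \<open>x + y\<omega> > 0\<close> and
  \<open>x - y\<xi> > 0\<close>. In a partition of \<open>\<lceil>\<xi>\<rceil> + 2 + \<omega>\<close> the coefficients \<open>y\<close> sum to 1. Were one of them
  negative, grouping the parts by the sign of \<open>y\<close> would write the number as a sum of totally positive
  \<open>a + P\<omega>\<close> and \<open>b - (P - 1)\<omega>\<close> with \<open>P \<ge> 2\<close>; then \<open>a > 2\<xi>\<close> and \<open>b > \<omega>\<close>, which forces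
  \<open>a + b > \<lceil>\<xi>\<rceil> + 2\<close>. So one part is \<open>x + \<omega>\<close> with \<open>x \<ge> \<lceil>\<xi>\<rceil>\<close>, and the others are positive rational
  integers with sum \<open>\<lceil>\<xi>\<rceil> + 2 - x \<le> 2\<close>.
\<close>

section \<open>Integer polynomials and quadratic algebraic integers\<close>

lemma map_poly_of_int_add:
  "map_poly of_int (p + q) = (map_poly of_int p + map_poly of_int q :: 'a::comm_ring_1 poly)"
  by (intro poly_eqI) (simp add: coeff_map_poly)

lemma map_poly_of_int_mult:
  "map_poly of_int (p * q) = (map_poly of_int p * map_poly of_int q :: 'a::comm_ring_1 poly)"
  by (intro poly_eqI) (simp add: coeff_map_poly coeff_mult)

lemma map_poly_of_int_smult:
  "map_poly of_int (smult c p) = (smult (of_int c) (map_poly of_int p) :: 'a::comm_ring_1 poly)"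
  by (intro poly_eqI) (simp add: coeff_map_poly)

text \<open>The only root of a linear integer polynomial is a quotient of integers. This serves to
  kill the remainder on division by a quadratic with root \<open>x\<close>.\<close>

lemma irrational_not_root_linear:
  fixes x :: real and r :: "int poly"
  assumes "x \<notin> \<rat>" "degree r < 2" "poly (map_poly of_int r) x = 0"
  shows "r = 0"
proof -
  have deg: "degree r \<le> 1" using assms(2) by simp
  have r: "r = [:coeff r 0, coeff r 1:]"
    by (intro poly_eqI) (use deg in \<open>auto simp: coeff_pCons coeff_eq_0 split: nat.splits\<close>)
  have eq: "of_int (coeff r 0) + x * of_int (coeff r 1) = 0"
    using assms(3) by (subst (asm) r) (simp add: map_poly_pCons)
  have "coeff r 1 = 0"
  proof (rule ccontr)
    assume nz: "coeff r 1 \<noteq> 0"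
    have "x = - of_int (coeff r 0) / of_int (coeff r 1)"
      using eq nz by (simp add: field_simps)
    also have "\<dots> \<in> \<rat>" by auto
    finally show False using assms(1) by simp
  qed
  with eq have "coeff r 0 = 0" by simp
  with \<open>coeff r 1 = 0\<close> r show ?thesis by simp
qed

text \<open>By Gauss's lemma the primitive polynomial \<open>q\<close> divides, over the integers, any monic integer
  polynomial with root \<open>x\<close>.\<close>

lemma algebraic_int_quadratic_lead_coeff_unit:
  fixes x :: real and q :: "int poly"
  assumes "algebraic_int x" "x \<notin> \<rat>"
    and q: "degree q = 2" "content q = 1" "poly (map_poly of_int q) x = 0"
  shows "lead_coeff q dvd 1"
proof -
  obtain p :: "int poly" where p: "poly (map_poly of_int p) x = 0" "lead_coeff p = 1"
    using assms(1) unfolding algebraic_int_altdef_ipoly by blast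
  have "q \<noteq> 0" using q(1) by auto
  \<comment> \<open>Since \<open>q\<close> need not be monic, division with remainder over the
    integers is possible only after scaling \<open>p\<close> by some nonzero
    \<open>a\<close>.\<close>
  from pseudo_mod[OF this, of p] obtain a s where as:
    "a \<noteq> 0" "smult a p = q * s + pseudo_mod p q"
    and deg: "pseudo_mod p q = 0 \<or> degree (pseudo_mod p q) < degree q"
    by blast
  have "poly (map_poly of_int (smult a p)) x = 0"
    by (simp add: map_poly_of_int_smult p(1))
  hence "poly (map_poly of_int (pseudo_mod p q)) x = 0"
    unfolding as(2) by (simp add: map_poly_of_int_add map_poly_of_int_mult q(3))
  hence "pseudo_mod p q = 0"
    using irrational_not_root_linear[OF assms(2)] deg q(1) by auto
  hence eq: "smult a p = q * s" using as(2) by simp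
  \<comment> \<open>Content is multiplicative and \<open>content q = 1\<close>, so \<open>a\<close>
    divides the content of \<open>s\<close> and can be cancelled.\<close>
  have "a dvd content (q * s)"
    unfolding eq[symmetric] content_smult by simp
  hence "[:a:] dvd s"
    by (simp add: content_mult q(2) const_poly_dvd_iff_dvd_content)
  then obtain s' where "s = smult a s'" by (auto elim!: dvdE)
  hence "smult a (p - q * s') = 0" using eq by (simp add: smult_diff_right)
  hence "p = q * s'" using as(1) by simp
  hence "lead_coeff q * lead_coeff s' = 1" using p(2) by (simp add: lead_coeff_mult)
  thus ?thesis by (metis dvd_triv_left)
qed

text \<open>Clearing denominators in the quadratic gives \<open>q\<close> with leading coefficient
  \<open>b * d\<close>. Its primitive part has a unit as leading coefficient, so
  \<open>b * d\<close> is the content of \<open>q\<close> up to sign and divides the other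
  coefficients too. Applied below to the trace \<open>t\<close> and the norm
  \<open>m\<close>.\<close>

lemma algebraic_int_quadratic_coeffs_Ints:
  fixes x t m :: real
  assumes x: "algebraic_int x" "x \<notin> \<rat>" and "t \<in> \<rat>" "m \<in> \<rat>" "x^2 - t * x + m = 0"
  shows "t \<in> \<int>" "m \<in> \<int>"
proof -
  obtain a b where t: "b > 0" "t = of_int a / of_int b"
    using assms(3) by (elim Rats_cases')
  obtain c d where m: "d > 0" "m = of_int c / of_int d"
    using assms(4) by (elim Rats_cases')
  define q where "q = [:b * c, - (a * d), b * d:]"
  have bd: "b * d \<noteq> 0" using t m by simp
  have degq: "degree q = 2" using bd by (simp add: q_def)
  have q0: "q \<noteq> 0" using bd by (simp add: q_def)
  have "poly (map_poly of_int q) x = of_int (b * d) * (x^2 - t * x + m)"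
    using t m by (simp add: q_def map_poly_pCons field_simps power2_eq_square)
  hence root: "poly (map_poly of_int q) x = 0" using assms(5) by simp
  define c' where "c' = content q"
  define q' where "q' = primitive_part q"
  have qq': "q = smult c' q'" by (simp add: q'_def c'_def)
  have c'0: "c' \<noteq> 0" using q0 by (auto simp: c'_def)
  have "degree q' = 2" using degq c'0 by (simp add: qq')
  moreover have "content q' = 1" using q0 by (simp add: q'_def)
  moreover have "poly (map_poly of_int q') x = 0"
    using root c'0 by (simp add: qq' map_poly_of_int_smult)
  ultimately have unit: "lead_coeff q' dvd 1"
    using algebraic_int_quadratic_lead_coeff_unit[OF x] by blast
  have "lead_coeff q = b * d" by (simp add: degq) (simp add: q_def numeral_2_eq_2)
  hence lc: "b * d = c' * lead_coeff q'" by (metis qq' lead_coeff_smult)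
  have "b * d dvd coeff q i" for i
  proof -
    have "b * d dvd c'" using lc unit by (metis dvd_refl mult_dvd_mono mult.right_neutral)
    thus ?thesis by (simp add: qq')
  qed
  from this[of 0] this[of 1] have "b * d dvd b * c" "b * d dvd a * d"
    by (simp_all add: q_def)
  hence "d dvd c" "b dvd a" using t m by auto
  thus "t \<in> \<int>" "m \<in> \<int>"
    using t m by (auto elim!: dvdE)
qed

section \<open>Consequences of squarefreeness\<close>

lemma rat_mult_square_Ints_imp_Ints:
  fixes r :: real
  assumes "squarefree D" "r \<in> \<rat>" "r^2 * of_int D \<in> \<int>"
  shows "r \<in> \<int>"
proof -
  obtain a b where r: "b > 0" "coprime a b" "r = of_int a / of_int b"
    using assms(2) by (elim Rats_cases')
  obtain k where "r^2 * of_int D = of_int k" using assms(3) by (auto elim: Ints_cases)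
  hence "of_int (a^2 * D) = (of_int (b^2 * k) :: real)"
    using r by (simp add: field_simps)
  hence "a^2 * D = b^2 * k" by linarith
  \<comment> \<open>The fraction is in lowest terms, so \<open>b^2\<close> must divide
    \<open>D\<close>, and squarefreeness makes \<open>b\<close> a unit.\<close>
  hence "b^2 dvd a^2 * D" by simp
  moreover have "coprime (b^2) (a^2)" using r by (simp add: coprime_commute)
  ultimately have "b^2 dvd D" by (simp add: coprime_dvd_mult_right_iff)
  hence "b dvd 1" using assms(1) by (rule squarefreeD[rotated])
  hence "b = 1" using r(1) by simp
  thus ?thesis using r by simp
qed

text \<open>A rational algebraic integer is an integer, so a rational root would make
  \<open>D\<close> a perfect square; the only squarefree one is 1.\<close>

lemma sqrt_squarefree_irrational:
  assumes "D \<ge> 2" "squarefree D"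
  shows "sqrt (of_int D) \<notin> \<rat>"
proof
  assume "sqrt (of_int D) \<in> \<rat>"
  with rational_algebraic_int_is_int[OF algebraic_int_sqrt, of "of_int D"]
  obtain k where k: "sqrt (of_int D) = of_int k" by (auto elim: Ints_cases)
  hence "of_int (k^2) = (of_int D :: real)" using assms(1)
    by (metis of_int_0_le_iff of_int_power order_trans real_sqrt_pow2 zero_le_numeral)
  hence "k^2 = D" by linarith
  with assms(2) have "k dvd 1" by (metis dvd_refl squarefreeD)
  hence "k = 1 \<or> k = -1" by auto
  with \<open>k^2 = D\<close> assms(1) show False by auto
qed

section \<open>Sums over multisets\<close>

lemma sum_mset_pos:
  fixes f :: "'a \<Rightarrow> 'b::linordered_idom"
  assumes "M \<noteq> {#}" "\<And>x. x \<in># M \<Longrightarrow> 0 < f x"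
  shows "0 < (\<Sum>x\<in>#M. f x)"
  using assms
proof (induction M)
  case (add x M)
  thus ?case by (cases "M = {#}") (auto intro: add_pos_pos)
qed simp

lemma sum_mset_nonneg_linordered:
  fixes f :: "'a \<Rightarrow> 'b::linordered_idom"
  assumes "\<And>x. x \<in># M \<Longrightarrow> 0 \<le> f x"
  shows "0 \<le> (\<Sum>x\<in>#M. f x)"
  using assms by (induction M) auto

text \<open>The four multisets are the partitions of 0, 1 and 2; they account for the final count of
  4.\<close>

lemma pos_int_mset_sum_le_2:
  fixes K :: "int multiset"
  assumes pos: "\<And>x. x \<in># K \<Longrightarrow> x > 0" and sum: "sum_mset K \<le> 2"
  shows "K \<in> {{#}, {#1#}, {#2#}, {#1, 1#}}"
proof (cases K)
  case (add x L)
  show ?thesis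
  proof (cases L)
    case (add y J)
    have "J = {#}"
    proof (rule ccontr)
      assume "J \<noteq> {#}"
      hence "0 < sum_mset J"
        using sum_mset_pos[of J "\<lambda>x. x"] pos add \<open>K = _\<close> by simp
      moreover have "x > 0" "y > 0" using pos add \<open>K = _\<close> by auto
      ultimately show False using sum add \<open>K = _\<close> by simp
    qed
    moreover have "x > 0" "y > 0" using pos add \<open>K = _\<close> by auto
    ultimately have "x = 1" "y = 1" using sum add \<open>K = _\<close> by simp_all
    thus ?thesis using \<open>J = _\<close> add \<open>K = _\<close> by simp
  next
    case empty
    hence "x = 1 \<or> x = 2" using pos sum add by auto
    thus ?thesis using empty add by auto
  qed
qed simp

section \<open>The ring of integers and conjugation\<close>

locale real_quad =
  fixes D :: int
  assumes D_ge_2: "D \<ge> 2" and sqfree: "squarefree D"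
begin

abbreviation s :: real where "s \<equiv> sqrt (of_int D)"

lemma s_irrat: "s \<notin> \<rat>"
  using sqrt_squarefree_irrational D_ge_2 sqfree by blast

lemma s_sq [simp]: "s * s = of_int D"
  using D_ge_2 by simp

text \<open>Irrationality of \<open>s\<close> makes rational coordinates unique, which is what makes
  the description in \<open>quad_conj\<close> single-valued.\<close>

lemma quad_eq_iff:
  assumes "a \<in> \<rat>" "b \<in> \<rat>" "c \<in> \<rat>" "d \<in> \<rat>"
  shows "a + b * s = c + d * s \<longleftrightarrow> a = c \<and> b = d"
proof
  assume eq: "a + b * s = c + d * s"
  have "b = d"
  proof (rule ccontr)
    assume "b \<noteq> d"
    hence "s = (a - c) / (d - b)" using eq by (simp add: field_simps)
    also have "\<dots> \<in> \<rat>" using assms by auto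
    finally show False using s_irrat by simp
  qed
  thus "a = c \<and> b = d" using eq by simp
qed auto

lemma quad_conj_eq:
  assumes "a \<in> \<rat>" "b \<in> \<rat>"
  shows "quad_conj D (a + b * s) = a - b * s"
  unfolding quad_conj_def using assms
  by (intro the_equality) (auto simp: quad_eq_iff)

lemma quad_fieldI: "a \<in> \<rat> \<Longrightarrow> b \<in> \<rat> \<Longrightarrow> x = a + b * s \<Longrightarrow> x \<in> quad_field D"
  unfolding quad_field_def by blast

text \<open>For \<open>x = a + b * s\<close> the trace \<open>T = 2 * a\<close> and the norm
  \<open>N\<close> are integers. Then \<open>(2 * b)^2 * D = T^2 - 4 * N\<close> is an integer, and
  squarefreeness makes \<open>U = 2 * b\<close> one as well.\<close>

lemma ring_of_ints_imp:
  assumes "x \<in> ring_of_ints D"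
  obtains T U :: int where "x = (of_int T + of_int U * s) / 2" "4 dvd T^2 - D * U^2"
proof -
  obtain a b where ab: "a \<in> \<rat>" "b \<in> \<rat>" "x = a + b * s" and alg: "algebraic_int x"
    using assms by (auto simp: ring_of_ints_def quad_field_def)
  show thesis
  proof (cases "b = 0")
    case True
    hence "x \<in> \<int>" using rational_algebraic_int_is_int[OF alg] ab by simp
    then obtain k where "x = of_int k" by (auto elim: Ints_cases)
    thus ?thesis using that[of "2 * k" 0] by simp
  next
    case False
    have irr: "x \<notin> \<rat>"
    proof
      assume x: "x \<in> \<rat>"
      have "x + 0 * s = a + b * s" using ab by simp
      thus False using quad_eq_iff[of x 0 a b] x ab False by simp
    qed
    have "x^2 - (2 * a) * x + (a^2 - b^2 * of_int D) = 0"
      unfolding ab(3) using D_ge_2 by (simp add: power2_eq_square algebra_simps)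
    moreover have "2 * a \<in> \<rat>" "a^2 - b^2 * of_int D \<in> \<rat>" using ab by auto
    ultimately have "2 * a \<in> \<int>" "a^2 - b^2 * of_int D \<in> \<int>"
      using algebraic_int_quadratic_coeffs_Ints[OF alg irr] by blast+
    then obtain T N where T: "2 * a = of_int T" and N: "a^2 - b^2 * of_int D = of_int N"
      by (auto elim!: Ints_cases)
    have TN: "(2 * b)^2 * of_int D = of_int (T^2 - 4 * N)"
      by (simp add: T[symmetric] N[symmetric] power2_eq_square algebra_simps)
    hence "(2 * b)^2 * of_int D \<in> \<int>" by simp
    moreover have "2 * b \<in> \<rat>" using ab by auto
    ultimately have "2 * b \<in> \<int>" using rat_mult_square_Ints_imp_Ints[OF sqfree] by blast
    then obtain U where U: "2 * b = of_int U" by (auto elim!: Ints_cases)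
    have "of_int (U^2 * D) = (of_int (T^2 - 4 * N) :: real)"
      using TN unfolding U by simp
    hence "U^2 * D = T^2 - 4 * N" by linarith
    hence "T^2 - D * U^2 = 4 * N" by (simp add: algebra_simps)
    moreover have "x = (of_int T + of_int U * s) / 2" 
      by (simp add: ab(3) T[symmetric] U[symmetric])
    ultimately show ?thesis using that[of T U] by simp
  qed
qed

lemma ring_of_ints_eq: "ring_of_ints D = {of_int x + of_int y * omega D | x y. True}"
proof (intro equalityI subsetI)
  fix z assume "z \<in> ring_of_ints D"
  then obtain T U :: int where z: "z = (of_int T + of_int U * s) / 2"
    and dv: "4 dvd T^2 - D * U^2" by (rule ring_of_ints_imp)
  \<comment> \<open>The parities of \<open>T\<close> and \<open>U\<close> are read off modulo 4:
    they agree if \<open>D mod 4 = 1\<close>, and both numbers are even if \<open>D mod 4\<close> is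
    2 or 3.\<close>
  have sq_mod: "v^2 mod 4 = (if even v then 0 else 1)" for v :: int
  proof (cases "even v")
    case False
    then obtain k where "v = 2 * k + 1" by (elim oddE)
    hence "v^2 = 4 * (k^2 + k) + 1" by (simp add: power2_eq_square algebra_simps)
    hence "v^2 mod 4 = 1" by presburger
    thus ?thesis using False by simp
  qed (auto elim!: evenE simp: power2_eq_square)
  have D4: "D mod 4 \<noteq> 0" 
    using squarefreeD[OF sqfree, of 2] by auto
  have md: "T^2 mod 4 = (D mod 4) * (U^2 mod 4) mod 4"
    using dv by (simp add: mod_eq_dvd_iff mod_mult_eq)
  have "\<exists>x y. z = of_int x + of_int y * omega D"
  proof (cases "D mod 4 = 1")
    case True
    with md have "even (T - U)" by (auto simp: sq_mod split: if_splits)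
    then obtain k where "T = U + 2 * k" by (metis evenE add.commute diff_add_cancel)
    hence "z = of_int k + of_int U * omega D"
      using z True by (simp add: omega_def field_simps)
    thus ?thesis by blast
  next
    case False
    have "even U" "even T"
      using md False D4 by (auto simp: sq_mod split: if_splits)
    then obtain k l where "T = 2 * k" "U = 2 * l" by (auto elim!: evenE)
    hence "z = of_int k + of_int l * omega D"
      using z False by (simp add: omega_def)
    thus ?thesis by blast
  qed
  thus "z \<in> {of_int x + of_int y * omega D | x y. True}" by blast
next
  fix z assume "z \<in> {of_int x + of_int y * omega D | x y. True}"
  then obtain x y :: int where z: "z = of_int x + of_int y * omega D" by blast
  show "z \<in> ring_of_ints D"
  proof (cases "D mod 4 = 1")
    case True
    have "4 dvd D - 1" using True by presburger
    then obtain k where "D - 1 = 4 * k" by (elim dvdE)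
    hence k: "D = 4 * k + 1" by simp
    have "z = (of_int x + of_int y / 2) + (of_int y / 2) * s"
      using True z by (simp add: omega_def field_simps)
    hence "z \<in> quad_field D" by (rule quad_fieldI[rotated 2]) auto
    \<comment> \<open>The coefficients are the trace and the norm of \<open>z\<close>, rewritten
      with \<open>D = 4 * k + 1\<close> so that they are visibly integers.\<close>
    moreover have "z^2 - of_int (2 * x + y) * z + of_int (x^2 + x * y - k * y^2) = 0"
    proof -
      have "2 * z = 2 * of_int x + of_int y + of_int y * s"
        using True z by (simp add: omega_def field_simps)
      moreover have "s * s = 4 * of_int k + 1" unfolding s_sq by (simp add: k)
      ultimately have "4 * (z^2 - (2 * of_int x + of_int y) * z
        + (of_int x^2 + of_int x * of_int y - of_int k * of_int y^2)) = 0" by algebra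
      thus ?thesis by simp
    qed
    hence "algebraic_int z"
      by (intro algebraic_int.intros[of "[:of_int (x^2 + x * y - k * y^2), - of_int (2 * x + y), 1:]"])
         (auto simp: coeff_pCons power2_eq_square algebra_simps split: nat.splits)
    ultimately show ?thesis by (simp add: ring_of_ints_def)
  next
    case False
    hence z: "z = of_int x + of_int y * s" using z by (simp add: omega_def)
    hence "z \<in> quad_field D" by (rule quad_fieldI[rotated 2]) auto
    moreover have "z^2 - of_int (2 * x) * z + of_int (x^2 - D * y^2) = 0"
      unfolding z using D_ge_2 by (simp add: power2_eq_square algebra_simps)
    hence "algebraic_int z"
      by (intro algebraic_int.intros[of "[:of_int (x^2 - D * y^2), - of_int (2 * x), 1:]"])
         (auto simp: coeff_pCons power2_eq_square algebra_simps split: nat.splits)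
    ultimately show ?thesis by (simp add: ring_of_ints_def)
  qed
qed

text \<open>In both cases \<open>- xi D\<close> is the Galois conjugate of
  \<open>omega D\<close>.\<close>

lemma quad_conj_omega:
  "quad_conj D (of_int x + of_int y * omega D) = of_int x - of_int y * xi D"
proof (cases "D mod 4 = 1")
  case True
  have "of_int x + of_int y * omega D = (of_int x + of_int y / 2) + (of_int y / 2) * s"
    using True by (simp add: omega_def field_simps)
  also have "quad_conj D \<dots> = (of_int x + of_int y / 2) - (of_int y / 2) * s"
    by (rule quad_conj_eq) auto
  also have "\<dots> = of_int x - of_int y * xi D"
    using True by (simp add: xi_def field_simps)
  finally show ?thesis .
next
  case False
  thus ?thesis using quad_conj_eq[of "of_int x" "of_int y"] by (simp add: omega_def xi_def)
qed

section \<open>Totally positive integers in coordinates\<close>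

lemma tot_pos_ints_eq:
  "tot_pos_ints D = {of_int x + of_int y * omega D | x y.
     of_int x + of_int y * omega D > 0 \<and> of_int x - of_int y * xi D > 0}"
  unfolding tot_pos_ints_def ring_of_ints_eq using quad_conj_omega by fastforce

lemma omega_coords_eq_iff:
  "of_int x + of_int y * omega D = of_int x' + of_int y' * omega D \<longleftrightarrow> x = x' \<and> y = y'"
proof
  assume eq: "of_int x + of_int y * omega D = of_int x' + of_int y' * omega D"
  show "x = x' \<and> y = y'"
  proof (cases "D mod 4 = 1")
    case True
    have "(of_int x + of_int y / 2) + (of_int y / 2) * s
      = (of_int x' + of_int y' / 2) + (of_int y' / 2) * s"
      using eq True by (simp add: omega_def field_simps)
    thus ?thesis by (subst (asm) quad_eq_iff) auto
  next
    case False
    thus ?thesis using eq quad_eq_iff[of "of_int x" "of_int y" "of_int x'" "of_int y'"]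
      by (simp add: omega_def)
  qed
qed auto

text \<open>Ensures that the ceiling of \<open>xi D\<close> exceeds \<open>xi D\<close> strictly, so
  that this ceiling plus \<open>omega D\<close> has a positive conjugate.\<close>

lemma xi_irrat: "xi D \<notin> \<rat>"
proof
  assume xi: "xi D \<in> \<rat>"
  have "s = (if D mod 4 = 1 then 2 * xi D + 1 else xi D)" by (simp add: xi_def field_simps)
  also have "\<dots> \<in> \<rat>" using xi by auto
  finally show False using s_irrat by simp
qed

text \<open>Integer pairs stand for elements in the basis 1, \<open>omega D\<close>, so that the
  parts of a partition can be sorted by their second coordinate and summed coordinatewise.\<close>

definition emb :: "int \<times> int \<Rightarrow> real" where
  "emb p = of_int (fst p) + of_int (snd p) * omega D"

definition emb_conj :: "int \<times> int \<Rightarrow> real" where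
  "emb_conj p = of_int (fst p) - of_int (snd p) * xi D"

lemma sum_emb: "(\<Sum>p\<in>#N. emb p) = emb (\<Sum>p\<in>#N. fst p, \<Sum>p\<in>#N. snd p)"
  by (induction N) (simp_all add: emb_def algebra_simps)

lemma sum_emb_conj: "(\<Sum>p\<in>#N. emb_conj p) = emb_conj (\<Sum>p\<in>#N. fst p, \<Sum>p\<in>#N. snd p)"
  by (induction N) (simp_all add: emb_conj_def algebra_simps)

lemma tot_pos_ints_emb: "tot_pos_ints D = emb ` {p. emb p > 0 \<and> emb_conj p > 0}"
  unfolding tot_pos_ints_eq by (auto simp: emb_def emb_conj_def image_iff) blast

lemma partition_coords:
  assumes "set_mset M \<subseteq> tot_pos_ints D"
  obtains N where "M = image_mset emb N" "\<And>p. p \<in># N \<Longrightarrow> emb p > 0 \<and> emb_conj p > 0"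
proof -
  have "\<exists>N. M = image_mset emb N \<and> (\<forall>p\<in>#N. emb p > 0 \<and> emb_conj p > 0)"
    using assms
  proof (induction M)
    case (add x M)
    then obtain N where N: "M = image_mset emb N" "\<forall>p\<in>#N. emb p > 0 \<and> emb_conj p > 0" by auto
    from add.prems obtain p where "x = emb p" "emb p > 0" "emb_conj p > 0"
      by (auto simp: tot_pos_ints_emb)
    with N show ?case by (intro exI[of _ "add_mset p N"]) auto
  qed simp
  thus ?thesis using that by blast
qed

section \<open>Size estimates and the shape of a partition\<close>

lemma sqrt_D_gt_1: "s > 1"
  using D_ge_2 by simp

lemma sqrt_D_gt_2: "D mod 4 = 1 \<Longrightarrow> s > 2"
proof -
  assume "D mod 4 = 1"
  hence "D \<ge> 5" using D_ge_2 by presburger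
  thus ?thesis by (intro real_less_rsqrt) simp
qed

lemma xi_pos: "xi D > 0" and omega_pos: "omega D > 0"
  using sqrt_D_gt_1 by (auto simp: xi_def omega_def simp del: real_sqrt_gt_1_iff real_sqrt_gt_0_iff)

text \<open>If the bound failed, \<open>b > omega D\<close> would leave \<open>a <= 2\<close>, and
  even \<open>a <= 1\<close> when \<open>D mod 4 = 1\<close>, because then
  \<open>omega D = xi D + 1\<close>. But \<open>2 * xi D\<close> exceeds 2 in the first case and 1
  in the second.\<close>

lemma ceiling_xi_bound:
  assumes "of_int a > 2 * xi D" "of_int b > omega D"
  shows "a + b > \<lceil>xi D\<rceil> + 2"
proof (rule ccontr)
  assume *: "\<not> ?thesis"
  show False
  proof (cases "D mod 4 = 1")
    case True
    have "omega D = xi D + 1" using True by (simp add: omega_def xi_def field_simps)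
    hence "\<lceil>xi D\<rceil> + 1 \<le> b" using assms(2) by linarith
    hence "a \<le> 1" using * by linarith
    hence "2 * xi D < 1" using assms(1) by linarith
    thus False using sqrt_D_gt_2[OF True] True by (simp add: xi_def)
  next
    case False
    hence eq: "omega D = s" "xi D = s" by (auto simp: omega_def xi_def)
    hence "\<lceil>xi D\<rceil> \<le> b" using assms(2) by linarith
    hence "a \<le> 2" using * by linarith
    hence "2 * s < 2" using assms(1) eq by linarith
    thus False using sqrt_D_gt_1 by simp
  qed
qed

lemma coords_nonneg:
  assumes tp: "\<And>p. p \<in># N \<Longrightarrow> emb p > 0 \<and> emb_conj p > 0"
    and sum: "(\<Sum>p\<in>#N. fst p) = \<lceil>xi D\<rceil> + 2" "(\<Sum>p\<in>#N. snd p) = 1"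
    and p: "p \<in># N"
  shows "snd p \<ge> 0"
proof (rule ccontr)
  assume neg: "\<not> snd p \<ge> 0"
  define A where "A = filter_mset (\<lambda>p. snd p \<ge> 0) N"
  define B where "B = filter_mset (\<lambda>p. \<not> snd p \<ge> 0) N"
  have N: "N = A + B" unfolding A_def B_def by (rule multiset_partition)
  define a b P Q where defs: "a = (\<Sum>p\<in>#A. fst p)" "b = (\<Sum>p\<in>#B. fst p)"
    "P = (\<Sum>p\<in>#A. snd p)" "Q = (\<Sum>p\<in>#B. - snd p)"
  have Bne: "B \<noteq> {#}" using p neg by (auto simp: B_def filter_mset_eq_conv)
  hence "Q > 0" unfolding defs by (rule sum_mset_pos) (auto simp: B_def)
  have Q': "(\<Sum>p\<in>#B. snd p) = - Q" unfolding defs by (induction B) auto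
  have sums: "a + b = \<lceil>xi D\<rceil> + 2" "P - Q = 1"
    using sum Q' by (auto simp: N defs)
  hence P: "P \<ge> 2" using \<open>Q > 0\<close> by simp
  hence "A \<noteq> {#}" by (auto simp: defs)
  \<comment> \<open>Each group is bounded by the embedding in which its \<open>omega D\<close> term
    counts against it: the conjugate for \<open>A\<close>, the identity for
    \<open>B\<close>.\<close>
  hence "0 < (\<Sum>p\<in>#A. emb_conj p)" by (rule sum_mset_pos) (use tp in \<open>auto simp: N\<close>)
  hence "of_int a > of_int P * xi D" unfolding sum_emb_conj by (simp add: defs emb_conj_def)
  moreover have "of_int P * xi D \<ge> 2 * xi D" using P xi_pos by (intro mult_right_mono) auto
  ultimately have a: "of_int a > 2 * xi D" by linarith
  have "0 < (\<Sum>p\<in>#B. emb p)" using Bne by (rule sum_mset_pos) (use tp in \<open>auto simp: N\<close>)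
  hence "of_int b > of_int Q * omega D" unfolding sum_emb using Q' by (simp add: defs emb_def)
  moreover have "of_int Q * omega D \<ge> 1 * omega D"
    using \<open>Q > 0\<close> omega_pos by (intro mult_right_mono) auto
  ultimately have "of_int b > omega D" by linarith
  from ceiling_xi_bound[OF a this] sums show False by simp
qed

text \<open>Nonnegative integers with sum 1 are a single 1 and zeros. Positivity of the conjugate
  bounds \<open>x\<close> from below, and positivity of the other parts makes them positive
  integers.\<close>

lemma partition_split:
  assumes tp: "\<And>p. p \<in># N \<Longrightarrow> emb p > 0 \<and> emb_conj p > 0"
    and sum: "(\<Sum>p\<in>#N. fst p) = \<lceil>xi D\<rceil> + 2" "(\<Sum>p\<in>#N. snd p) = 1"
  obtains x K where "N = add_mset (x, 1) (image_mset (\<lambda>k. (k, 0)) K)" "x \<ge> \<lceil>xi D\<rceil>"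
    "\<And>k. k \<in># K \<Longrightarrow> k > 0" "x + sum_mset K = \<lceil>xi D\<rceil> + 2"
proof -
  have nonneg: "snd p \<ge> 0" if "p \<in># N" for p using coords_nonneg[OF tp sum that] .
  have "\<exists>p\<in>#N. snd p \<noteq> 0"
  proof (rule ccontr)
    assume "\<not> ?thesis"
    hence "image_mset snd N = image_mset (\<lambda>_. 0) N" by (intro image_mset_cong) auto
    thus False using sum(2) by simp
  qed
  then obtain p where p: "p \<in># N" "snd p \<noteq> 0" by blast
  define R where "R = N - {#p#}"
  have N: "N = add_mset p R" using p by (simp add: R_def)
  have p1: "snd p \<ge> 1" using nonneg[OF p(1)] p(2) by simp
  have Rzero: "snd q = 0" if "q \<in># R" for q
  proof -
    \<comment> \<open>With \<open>p\<close> and \<open>q\<close> both taken out, the remaining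
      second coordinates still have a nonnegative sum, so those of \<open>p\<close> and
      \<open>q\<close> add up to at most 1.\<close>
    have "R = add_mset q (R - {#q#})" using that by simp
    hence "N = add_mset p (add_mset q (R - {#q#}))" using N by simp
    moreover from this have "0 \<le> (\<Sum>r\<in>#R - {#q#}. snd r)"
      by (intro sum_mset_nonneg_linordered) (auto intro!: nonneg)
    ultimately have "snd p + snd q \<le> 1" using sum(2) by simp
    moreover have "snd q \<ge> 0" using nonneg that N by simp
    ultimately show ?thesis using p1 by simp
  qed
  define K where "K = image_mset fst R"
  have "image_mset (\<lambda>k. (k, 0)) K = image_mset (\<lambda>q. q) R"
    unfolding K_def image_mset.compositionality
    by (intro image_mset_cong) (auto simp: Rzero prod_eq_iff)
  hence R: "R = image_mset (\<lambda>k. (k, 0)) K" by simp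
  have "snd p = 1" using sum(2) by (simp add: N R image_mset.compositionality comp_def)
  show thesis
  proof (rule that)
    show "N = add_mset (fst p, 1) (image_mset (\<lambda>k. (k, 0)) K)"
      using N R \<open>snd p = 1\<close> by (metis prod.collapse)
    have "of_int (fst p) > xi D" using tp[OF p(1)] \<open>snd p = 1\<close> by (simp add: emb_conj_def)
    thus "fst p \<ge> \<lceil>xi D\<rceil>" by linarith
    show "k > 0" if "k \<in># K" for k
      using tp[of "(k, 0)"] that by (auto simp: N R emb_def)
    show "fst p + sum_mset K = \<lceil>xi D\<rceil> + 2"
      using sum(1) by (simp add: N K_def)
  qed
qed

section \<open>The four partitions\<close>

lemma emb_inject [simp]: "emb p = emb q \<longleftrightarrow> p = q"
  by (simp add: emb_def omega_coords_eq_iff prod_eq_iff)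

text \<open>The rational parts form a partition of \<open>c + 2 - x\<close>, which is 0, 1 or 2:
  there are two choices for \<open>x = c\<close> and one each for \<open>x = c + 1\<close> and
  \<open>x = c + 2\<close>.\<close>

lemma partitions_eq:
  defines "c \<equiv> \<lceil>xi D\<rceil>"
  shows "partitions D (of_int (c + 2) + omega D) =
    {{#emb (c, 1), emb (2, 0)#}, {#emb (c, 1), emb (1, 0), emb (1, 0)#},
     {#emb (c + 1, 1), emb (1, 0)#}, {#emb (c + 2, 1)#}}" (is "?L = ?R")
proof (intro equalityI subsetI)
  fix M assume "M \<in> ?L"
  hence M: "set_mset M \<subseteq> tot_pos_ints D" "sum_mset M = emb (c + 2, 1)"
    by (auto simp: partitions_def emb_def)
  obtain N where N: "M = image_mset emb N" "\<And>p. p \<in># N \<Longrightarrow> emb p > 0 \<and> emb_conj p > 0"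
    using partition_coords[OF M(1)] by blast
  have "emb (\<Sum>p\<in>#N. fst p, \<Sum>p\<in>#N. snd p) = emb (c + 2, 1)"
    using M(2) unfolding N(1) sum_emb .
  hence "(\<Sum>p\<in>#N. fst p) = \<lceil>xi D\<rceil> + 2" "(\<Sum>p\<in>#N. snd p) = 1" by (simp_all add: c_def)
  from partition_split[OF N(2) this] obtain x K where
    NK: "N = add_mset (x, 1) (image_mset (\<lambda>k. (k, 0)) K)" and x: "x \<ge> c"
    and K: "\<And>k. k \<in># K \<Longrightarrow> k > 0" "x + sum_mset K = c + 2"
    unfolding c_def by metis
  have "K \<in> {{#}, {#1#}, {#2#}, {#1, 1#}}"
    using K x by (intro pos_int_mset_sum_le_2) auto
  then consider "K = {#}" "x = c + 2" | "K = {#1#}" "x = c + 1" | "K = {#2#}" "x = c"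
    | "K = {#1, 1#}" "x = c"
    using K(2) by force
  thus "M \<in> ?R" by cases (auto simp: N(1) NK)
next
  have c: "real_of_int c > xi D"
    using xi_irrat unfolding c_def by (metis Rats_of_int le_of_int_ceiling order_le_less)
  hence "real_of_int c > 0" using xi_pos by linarith
  \<comment> \<open>The natural offset \<open>k\<close> covers the first coordinates
    \<open>c\<close>, \<open>c + 1\<close> and \<open>c + 2\<close> at once.\<close>
  hence tp: "emb (c + of_nat k, 1) \<in> tot_pos_ints D" for k
    using c omega_pos unfolding tot_pos_ints_emb
    by (intro imageI) (auto simp: emb_def emb_conj_def intro!: add_pos_pos)
  have "emb (c, 1) \<in> tot_pos_ints D" "emb (c + 1, 1) \<in> tot_pos_ints D"
    "emb (c + 2, 1) \<in> tot_pos_ints D"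
    using tp[of 0] tp[of 1] tp[of 2] by simp_all
  moreover have "emb (k, 0) \<in> tot_pos_ints D" if "k > 0" for k
    unfolding tot_pos_ints_emb using that by (intro imageI) (simp add: emb_def emb_conj_def)
  ultimately show "M \<in> ?L" if "M \<in> ?R" for M
    using that by (auto simp: partitions_def) (simp_all add: emb_def)
qed

end

theorem theorem6p1:
  fixes D :: int and \<alpha> :: real
  assumes "D \<ge> 2" and "squarefree D"
    and "\<alpha> = of_int (\<lceil>xi D\<rceil> + 2) + omega D"
  shows "num_partitions D \<alpha> = 4"
proof -
  interpret real_quad D using assms by unfold_locales
  \<comment> \<open>It remains to see that the four multisets are distinct; injectivity of
    \<open>emb\<close> reduces this to comparing integer pairs.\<close>
  show ?thesis
    unfolding num_partitions_def assms(3) partitions_eq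
    by (simp add: add_eq_conv_diff)
qed

end
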